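(* For all integers $k,d\ge 1$ (and every $n$), the randomized query complexity of the gap group testing (GGT) problem with parameters $k$ and $d$ is $O\big(\min\{k\log k,\;1+(k/d)^2\}\big)$.
   Context: Let $n\ge 1$ and $[n]=\{1,\dots,n\}$. Let $\mathcal X$ be the family of all subsets of $[n]$ of size exactly $k$ and $\mathcal Y$ the family of all subsets of $[n]$ of size exactly $k+d$. Define $\widetilde{\mathcal X}=\{f:2^{[n]}\to\{0,1\}\mid \exists A\in\mathcal X\ \forall S\subseteq[n]:\ S\cap A=\emptyset\Rightarrow f(S)=0\}$ and $\widetilde{\mathcal Y}=\{f:2^{[n]}\to\{0,1\}\mid \exists B\in\mathcal Y\ \forall S\subseteq[n]:\ S\cap B\neq\emptyset\Rightarrow f(S)=1\}$. In the GGT problem with parameters $k,d$, one is given oracle access to $f\in\widetilde{\mathcal X}\cup\widetilde{\mathcal Y}$ (a query on $S\subseteq[n]$ returns $f(S)$) and must decide whether $f\in\widetilde{\mathcal X}$ or $f\in\widetilde{\mathcal Y}$. The randomized query complexity is the minimum, over randomized algorithms that answer correctly with probability at least $2/3$ on every allowed input, of the worst-case number of queries.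
   Formalization: The term k log k is read as max{1, k log k} with log base 2, because at k = 1 it would be 0 while at least one query is needed once n ≥ 1 + d; nothing changes for k ≥ 2. *)

theory Defs
  imports "HOL-Probability.Probability"
begin

section \<open>Randomized query complexity of promise problems\<close>

text \<open>A deterministic adaptive query algorithm. In \<open>Query q t0 t1\<close> the algorithm queries \<open>q\<close>
  and continues with \<open>t0\<close> if the oracle answers 0 (\<open>False\<close>) and with \<open>t1\<close> if it answers 1
  (\<open>True\<close>).\<close>

datatype 'q dtree = Answer bool | Query 'q "'q dtree" "'q dtree"

primrec queries :: "'q dtree \<Rightarrow> 'q set" where
  "queries (Answer b) = {}"
| "queries (Query q t0 t1) = insert q (queries t0 \<union> queries t1)"

primrec run :: "'q dtree \<Rightarrow> ('q \<Rightarrow> bool) \<Rightarrow> bool" where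
  "run (Answer b) f = b"
| "run (Query q t0 t1) f = (if f q then run t1 f else run t0 f)"

primrec num_queries :: "'q dtree \<Rightarrow> ('q \<Rightarrow> bool) \<Rightarrow> nat" where
  "num_queries (Answer b) f = 0"
| "num_queries (Query q t0 t1) f = Suc (if f q then num_queries t1 f else num_queries t0 f)"

text \<open>A randomized algorithm is a probability distribution over deterministic ones. It decides
  the promise problem \<open>(F1, F2)\<close> for oracles with query domain \<open>Q\<close>; the answer \<open>True\<close> stands for
  "the oracle is in \<open>F1\<close>", the answer \<open>False\<close> for "the oracle is in \<open>F2\<close>". The number of queries
  is bounded for every allowed oracle and every outcome of the random choices.\<close>

definition rand_decides ::
  "'q dtree pmf \<Rightarrow> 'q set \<Rightarrow> ('q \<Rightarrow> bool) set \<Rightarrow> ('q \<Rightarrow> bool) set \<Rightarrow> bool" where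
  "rand_decides p Q F1 F2 \<longleftrightarrow>
     (\<forall>t\<in>set_pmf p. queries t \<subseteq> Q) \<and>
     (\<forall>f\<in>F1. measure_pmf.prob p {t. run t f = True} \<ge> 2 / 3) \<and>
     (\<forall>f\<in>F2. measure_pmf.prob p {t. run t f = False} \<ge> 2 / 3)"

definition makes_at_most ::
  "'q dtree pmf \<Rightarrow> ('q \<Rightarrow> bool) set \<Rightarrow> nat \<Rightarrow> bool" where
  "makes_at_most p F m \<longleftrightarrow> (\<forall>t\<in>set_pmf p. \<forall>f\<in>F. num_queries t f \<le> m)"

definition rand_query_complexity ::
  "'q set \<Rightarrow> ('q \<Rightarrow> bool) set \<Rightarrow> ('q \<Rightarrow> bool) set \<Rightarrow> nat" where
  "rand_query_complexity Q F1 F2 =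
     (LEAST m. \<exists>p. rand_decides p Q F1 F2 \<and> makes_at_most p (F1 \<union> F2) m)"

section \<open>Gap group testing\<close>

text \<open>Functions from the subsets of \<open>{1..n}\<close> to \<open>{0,1}\<close> are extensional functions into \<^typ>\<open>bool\<close>,
  with \<open>True\<close> for 1.\<close>

definition ggt_X :: "nat \<Rightarrow> nat \<Rightarrow> (nat set \<Rightarrow> bool) set" where
  "ggt_X n k = {f \<in> Pow {1..n} \<rightarrow>\<^sub>E UNIV.
     \<exists>A. A \<subseteq> {1..n} \<and> card A = k \<and>
       (\<forall>S. S \<subseteq> {1..n} \<longrightarrow> S \<inter> A = {} \<longrightarrow> f S = False)}"

definition ggt_Y :: "nat \<Rightarrow> nat \<Rightarrow> nat \<Rightarrow> (nat set \<Rightarrow> bool) set" where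
  "ggt_Y n k d = {f \<in> Pow {1..n} \<rightarrow>\<^sub>E UNIV.
     \<exists>B. B \<subseteq> {1..n} \<and> card B = k + d \<and>
       (\<forall>S. S \<subseteq> {1..n} \<longrightarrow> S \<inter> B \<noteq> {} \<longrightarrow> f S = True)}"

definition ggt_complexity :: "nat \<Rightarrow> nat \<Rightarrow> nat \<Rightarrow> nat" where
  "ggt_complexity n k d = rand_query_complexity (Pow {1..n}) (ggt_X n k) (ggt_Y n k d)"

text \<open>The function \<open>k log k\<close> inside the O-notation vanishes at \<open>k = 1\<close>, where the problem still needs
  a query as soon as \<open>n \<ge> 1 + d\<close>. Hence the \<open>max 1\<close>; it has no effect for \<open>k \<ge> 2\<close>, because then
  \<open>k * log 2 k \<ge> 2\<close>.\<close>

definition ggt_bound :: "nat \<Rightarrow> nat \<Rightarrow> real" where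
  "ggt_bound k d = min (max 1 (real k * log 2 (real k))) (1 + (real k / real d)\<^sup>2)"

end

theory Submission
  imports Defs "HOL-Probability.Hoeffding"
begin

text \<open>Two algorithms are combined. For the bound \<open>1 + (k/d)\<^sup>2\<close>, query independent random sets that
  contain each element with probability \<open>1/(k+1)\<close>. Such a set misses \<open>k\<close> given points with
  probability at least \<open>1/3\<close>, and misses \<open>k + d\<close> given points with a probability smaller by
  \<open>\<Omega>(d/(k+d))\<close>; Hoeffding's inequality shows that the number of 0-answers among \<open>O(1 + (k/d)\<^sup>2)\<close>
  queries separates the two cases.

  For the bound \<open>k log k\<close>, hash the elements into \<open>O(k\<^sup>2)\<close> buckets, so that \<open>k + 1\<close> given points are
  separated with probability at least \<open>2/3\<close>, and search the binary tree over the buckets, descending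
  only below 1-answers. The nodes of one level are disjoint, so an oracle in \<open>ggt_X\<close> answers 1
  to at most \<open>k\<close> of them; for an oracle in \<open>ggt_Y\<close> the \<open>k + 1\<close> separated points force more than
  \<open>k\<close> such nodes at the bottom. Aborting when a level exceeds \<open>k\<close> bounds the queries per
  level by \<open>2k\<close>.\<close>

section \<open>Batches of non-adaptive queries\<close>

lemma rand_query_complexity_le:
  assumes "rand_decides p Q F1 F2" "makes_at_most p (F1 \<union> F2) m"
  shows "rand_query_complexity Q F1 F2 \<le> m"
  unfolding rand_query_complexity_def by (rule Least_le) (use assms in blast)

text \<open>Continuation style: \<open>c\<close> receives the indices answered 1, in order, so one
  construct serves both the sampling and each level of the search.\<close>

primrec query_all :: "('i \<Rightarrow> 'q) \<Rightarrow> 'i list \<Rightarrow> ('i list \<Rightarrow> 'q dtree) \<Rightarrow> 'q dtree" where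
  "query_all g [] c = c []"
| "query_all g (i # is) c = Query (g i) (query_all g is c) (query_all g is (\<lambda>js. c (i # js)))"

lemma run_query_all:
  "run (query_all g is c) f = run (c (filter (\<lambda>i. f (g i)) is)) f"
  by (induction "is" arbitrary: c) auto

lemma num_queries_query_all:
  "num_queries (query_all g is c) f = length is + num_queries (c (filter (\<lambda>i. f (g i)) is)) f"
  by (induction "is" arbitrary: c) auto

lemma queries_query_all:
  assumes "g ` set is \<subseteq> Q" "\<And>js. queries (c js) \<subseteq> Q"
  shows "queries (query_all g is c) \<subseteq> Q"
  using assms by (induction "is" arbitrary: c) auto

section \<open>Threshold sampling\<close>

text \<open>Applying \<open>P\<close> to independent samples gives independent Bernoulli trials, so
  tail bounds for \<open>binomial_pmf\<close> become available.\<close>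

lemma card_Pi_pmf_eq_binomial_pmf:
  fixes D :: "'q pmf"
  shows "map_pmf (\<lambda>s. card {i\<in>{..<m}. P (s i)}) (Pi_pmf {..<m} z (\<lambda>_. D)) =
         binomial_pmf m (measure_pmf.prob D {x. P x})"
proof -
  let ?q = "measure_pmf.prob D {x. P x}"
  have "pmf (map_pmf P D) b = pmf (bernoulli_pmf ?q) b" for b
  proof (cases b)
    case True
    then show ?thesis by (simp add: pmf_map vimage_def)
  next
    case False
    then show ?thesis
      using measure_pmf.prob_compl[of "{x. P x}" D]
      by (simp add: pmf_map vimage_def Compl_eq_Diff_UNIV[symmetric] Collect_neg_eq)
  qed
  then have "map_pmf P D = bernoulli_pmf ?q" by (rule pmf_eqI)
  then have "binomial_pmf m ?q =
      map_pmf (\<lambda>v. card {i\<in>{..<m}. v i}) (Pi_pmf {..<m} (P z) (\<lambda>_. map_pmf P D))"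
    by (simp add: binomial_pmf_altdef'[of "{..<m}" m ?q "P z"])
  also have "\<dots> = map_pmf (\<lambda>s. card {i\<in>{..<m}. P (s i)}) (Pi_pmf {..<m} z (\<lambda>_. D))"
    by (subst Pi_pmf_map[of _ P z]) (simp_all add: pmf.map_comp o_def)
  finally show ?thesis ..
qed

text \<open>Accept if the number of 0-answers reaches the midpoint of \<open>m * a\<close> and
  \<open>m * b\<close>. An error requires a deviation of at least \<open>m * (a - b) / 2\<close>
  from the mean, which Hoeffding's inequality bounds by \<open>exp (-2)\<close>.\<close>

lemma rand_query_complexity_sampling:
  fixes D :: "'q pmf" and a b :: real
  assumes D: "set_pmf D \<subseteq> Q"
    and F1: "\<And>f. f \<in> F1 \<Longrightarrow> measure_pmf.prob D {q. \<not> f q} \<ge> a"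
    and F2: "\<And>f. f \<in> F2 \<Longrightarrow> measure_pmf.prob D {q. \<not> f q} \<le> b"
    and ab: "b < a" and m: "real m * (a - b)\<^sup>2 \<ge> 4"
  shows "rand_query_complexity Q F1 F2 \<le> m"
proof -
  have mpos: "m > 0" using m by (intro Nat.gr0I) auto
  obtain z where z: "z \<in> set_pmf D" using set_pmf_not_empty[of D] by blast
  define thr where "thr = real m * (a + b) / 2"
  define \<epsilon> where "\<epsilon> = real m * (a - b) / 2"
  \<comment> \<open>\<open>js\<close> lists the 1-answers, so \<open>m - length js\<close> counts
    the 0-answers.\<close>
  define build where "build = (\<lambda>s. query_all s [0..<m]
     (\<lambda>js. Answer (real (m - length js) \<ge> thr)) :: 'q dtree)"
  define S where "S = Pi_pmf {..<m} z (\<lambda>_. D)"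
  have eps: "\<epsilon> \<ge> 0" unfolding \<epsilon>_def using ab by simp
  have "exp (-2 * \<epsilon>\<^sup>2 / m) = exp (- (real m * (a - b)\<^sup>2 / 2))"
    unfolding \<epsilon>_def using mpos by (simp add: power2_eq_square field_simps)
  also have "\<dots> \<le> exp (-2)" using m by simp
  also have "\<dots> \<le> (1/3 :: real)"
    using exp_ge_add_one_self[of "2::real"] by (simp add: exp_minus field_simps)
  finally have tail: "exp (-2 * \<epsilon>\<^sup>2 / m) \<le> 1/3" .
  have run: "run (build s) f \<longleftrightarrow> real (card {i\<in>{..<m}. \<not> f (s i)}) \<ge> thr" for s f
  proof -
    have "length (filter (\<lambda>i. \<not> f (s i)) [0..<m]) = card {i\<in>{..<m}. \<not> f (s i)}"
      by (subst distinct_card[symmetric]) (auto intro!: arg_cong[where f = card])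
    then have "length (filter (\<lambda>i. f (s i)) [0..<m]) + card {i\<in>{..<m}. \<not> f (s i)} = m"
      using sum_length_filter_compl[of "\<lambda>i. f (s i)" "[0..<m]"] by simp
    then have "m - length (filter (\<lambda>i. f (s i)) [0..<m]) = card {i\<in>{..<m}. \<not> f (s i)}"
      by linarith
    then show ?thesis by (simp add: build_def run_query_all)
  qed
  \<comment> \<open>Used with \<open>R\<close> the identity and with \<open>Not\<close>: both
    success probabilities become binomial ones.\<close>
  have prob: "measure_pmf.prob (map_pmf build S) {t. R (run t f)} =
      measure_pmf.prob (binomial_pmf m (measure_pmf.prob D {q. \<not> f q})) {x. R (real x \<ge> thr)}"
    for R f
    unfolding card_Pi_pmf_eq_binomial_pmf[where P = "\<lambda>q. \<not> f q" and z = z, symmetric]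
    by (simp add: vimage_def run S_def)
  have "rand_decides (map_pmf build S) Q F1 F2"
    unfolding rand_decides_def
  proof (intro conjI ballI)
    fix t assume "t \<in> set_pmf (map_pmf build S)"
    then obtain s where s: "s \<in> set_pmf S" "t = build s" by auto
    from s(1) have "\<forall>i<m. s i \<in> Q"
      using D unfolding S_def by (auto simp: set_Pi_pmf PiE_dflt_def)
    then show "queries t \<subseteq> Q"
      unfolding s(2) build_def by (intro queries_query_all) auto
  next
    fix f assume f: "f \<in> F1"
    define q where "q = measure_pmf.prob D {q. \<not> f q}"
    let ?B = "binomial_pmf m q"
    interpret binomial_distribution m q by unfold_locales (simp add: q_def)
    have "thr \<le> real m * q - \<epsilon>"
      using F1[OF f] mult_left_mono[of a q "real m"] unfolding thr_def \<epsilon>_def q_def[symmetric]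
      by (simp add: field_simps)
    then have "measure_pmf.prob ?B {x. \<not> real x \<ge> thr} \<le> measure_pmf.prob ?B {x. x \<le> m * q - \<epsilon>}"
      by (intro measure_pmf.finite_measure_mono) auto
    also have "\<dots> \<le> 1/3" using prob_le[OF mpos eps] tail by linarith
    finally have "measure_pmf.prob ?B {x. real x \<ge> thr} \<ge> 2/3"
      using measure_pmf.prob_compl[of "{x. real x \<ge> thr}" ?B]
      by (simp add: Compl_eq_Diff_UNIV[symmetric] Collect_neg_eq)
    then show "2 / 3 \<le> measure_pmf.prob (map_pmf build S) {t. run t f = True}"
      using prob[of "\<lambda>x. x" f] by (simp add: q_def)
  next
    fix f assume f: "f \<in> F2"
    define q where "q = measure_pmf.prob D {q. \<not> f q}"
    let ?B = "binomial_pmf m q"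
    interpret binomial_distribution m q by unfold_locales (simp add: q_def)
    have "thr \<ge> real m * q + \<epsilon>"
      using F2[OF f] mult_left_mono[of q b "real m"] unfolding thr_def \<epsilon>_def q_def[symmetric]
      by (simp add: field_simps)
    then have "measure_pmf.prob ?B {x. real x \<ge> thr} \<le> measure_pmf.prob ?B {x. x \<ge> m * q + \<epsilon>}"
      by (intro measure_pmf.finite_measure_mono) auto
    also have "\<dots> \<le> 1/3" using prob_ge[OF mpos eps] tail by linarith
    finally have "measure_pmf.prob ?B {x. \<not> real x \<ge> thr} \<ge> 2/3"
      using measure_pmf.prob_compl[of "{x. real x \<ge> thr}" ?B]
      by (simp add: Compl_eq_Diff_UNIV[symmetric] Collect_neg_eq)
    then show "2 / 3 \<le> measure_pmf.prob (map_pmf build S) {t. run t f = False}"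
      using prob[of Not f] by (simp add: q_def)
  qed
  moreover have "makes_at_most (map_pmf build S) (F1 \<union> F2) m"
    by (auto simp: makes_at_most_def build_def num_queries_query_all)
  ultimately show ?thesis by (rule rand_query_complexity_le)
qed

section \<open>Miss probabilities of random subsets\<close>

lemma prob_random_subset_disjoint:
  fixes p :: real
  assumes "A \<subseteq> V" "finite V" "0 \<le> p" "p \<le> 1"
  shows "measure_pmf.prob (map_pmf (\<lambda>s. {x\<in>V. s x}) (Pi_pmf V False (\<lambda>_. bernoulli_pmf p)))
           {S. S \<inter> A = {}} = (1 - p) ^ card A"
proof -
  let ?P = "Pi_pmf V False (\<lambda>_. bernoulli_pmf p)"
  \<comment> \<open>Missing \<open>A\<close> is a product event: the membership bits of
    \<open>A\<close> are forced to \<open>False\<close>, the others are free.\<close>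
  have "measure_pmf.prob (map_pmf (\<lambda>s. {x\<in>V. s x}) ?P) {S. S \<inter> A = {}} =
        measure_pmf.prob ?P (Pi V (\<lambda>x. if x \<in> A then {False} else UNIV))"
    by (simp add: vimage_def) (rule arg_cong[where f = "measure_pmf.prob ?P"],
        use assms(1) in \<open>fastforce simp: Pi_iff split: if_splits\<close>)
  also have "\<dots> = (\<Prod>x\<in>V. if x \<in> A then 1 - p else 1)"
    by (subst measure_Pi_pmf_Pi[OF assms(2)], rule prod.cong)
       (use assms in \<open>auto simp: measure_pmf_single\<close>)
  also have "\<dots> = (1 - p) ^ card A"
    using assms by (subst prod.If_cases) (auto simp: Int_absorb1)
  finally show ?thesis .
qed

text \<open>The gap is \<open>(1 - p) ^ k * (1 - (1 - p) ^ d)\<close>. The first factor is at least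
  1/3 because \<open>(1 + 1 / k) ^ k\<close> is at most e; the second is bounded below through
  Bernoulli's inequality.\<close>

lemma miss_probability_gap:
  fixes k d :: nat
  assumes "k \<ge> 1" "d \<ge> 1"
  defines "p \<equiv> 1 / (real k + 1)"
  shows "(1 - p) ^ k - (1 - p) ^ (k + d) \<ge> real d / (3 * (2 * real k + real d))"
proof -
  have p: "0 < p" "p < 1" and k0: "real k > 0" using assms by (auto simp: p_def)
  have "(1 + 1 / real k) ^ k \<le> exp 1"
    using exp_ge_one_plus_x_over_n_power_n[of k 1] assms by simp
  then have le3: "(1 + 1 / real k) ^ k \<le> 3" using exp_le by linarith
  have "1 - p = inverse (1 + 1 / real k)" using k0 by (simp add: p_def field_simps)
  then have "(1 - p) ^ k = inverse ((1 + 1 / real k) ^ k)" by (simp add: power_inverse)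
  also have "\<dots> \<ge> inverse 3" using le3 k0 by (intro le_imp_inverse_le zero_less_power) (auto intro: add_pos_nonneg)
  finally have a: "(1 - p) ^ k \<ge> 1/3" by simp
  \<comment> \<open>\<open>(1 - p) * (1 + p) \<le> 1\<close> turns Bernoulli's lower bound on
    \<open>(1 + p) ^ d\<close> into an upper bound on \<open>(1 - p) ^ d\<close>.\<close>
  have "(1 - p) ^ d * (1 + real d * p) \<le> (1 - p) ^ d * (1 + p) ^ d"
    using Bernoulli_inequality[of p d] p by (intro mult_left_mono) (auto simp: mult.commute)
  also have "\<dots> = (1 - p\<^sup>2) ^ d"
    by (simp add: power_mult_distrib[symmetric] power2_eq_square algebra_simps)
  also have "\<dots> \<le> 1" using p by (intro power_le_one) (auto simp: power2_eq_square mult_le_one)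
  finally have "(1 - p) ^ d * (1 + real d * p) \<le> 1" .
  moreover have "1 + real d * p > 0" using p by (simp add: add_pos_nonneg)
  ultimately have "(1 - p) ^ d \<le> 1 / (1 + real d * p)" by (simp add: pos_le_divide_eq)
  also have "\<dots> = 1 - real d / (real k + 1 + real d)"
    using k0 by (simp add: p_def field_simps)
  \<comment> \<open>\<open>k + 1 \<le> 2 * k\<close> makes the bound a function of
    \<open>k / d\<close> alone.\<close>
  also have "\<dots> \<le> 1 - real d / (2 * real k + real d)"
    using assms by (auto intro!: divide_left_mono mult_pos_pos)
  finally have "1 - (1 - p) ^ d \<ge> real d / (2 * real k + real d)" by simp
  with a have "1/3 * (real d / (2 * real k + real d)) \<le> (1 - p) ^ k * (1 - (1 - p) ^ d)"
    using p by (intro mult_mono) auto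
  then show ?thesis by (simp add: power_add right_diff_distrib)
qed

lemma ggt_complexity_sampling:
  assumes "k \<ge> 1" "d \<ge> 1"
  shows "real (ggt_complexity n k d) \<le> 289 * (1 + (real k / real d)\<^sup>2)"
proof -
  define p where "p = 1 / (real k + 1)"
  define a where "a = (1 - p) ^ k"
  define b where "b = (1 - p) ^ (k + d)"
  define V where "V = {1..n}"
  define D where "D = map_pmf (\<lambda>s. {x\<in>V. s x}) (Pi_pmf V False (\<lambda>_. bernoulli_pmf p))"
  define r where "r = real k / real d"
  \<comment> \<open>A gap of \<open>1 / (3 * (2 * r + 1))\<close> calls for
    \<open>36 * (2 * r + 1)\<^sup>2\<close> queries, and
    \<open>(2 * r + 1)\<^sup>2 \<le> 8 * (1 + r\<^sup>2)\<close>; hence 288 = 36 * 8.\<close>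
  define m where "m = nat \<lceil>288 * (1 + r\<^sup>2)\<rceil>"
  have p: "0 \<le> p" "p \<le> 1" by (auto simp: p_def)
  have V: "finite V" by (simp add: V_def)
  have DQ: "set_pmf D \<subseteq> Pow V" by (auto simp: D_def)
  have d0: "real d > 0" "real k > 0" using assms by auto
  have r0: "r \<ge> 0" by (simp add: r_def)
  have gap: "a - b \<ge> 1 / (3 * (2 * r + 1))"
  proof -
    have "1 / (3 * (2 * r + 1)) = real d / (3 * (2 * real k + real d))"
      using d0 by (simp add: r_def field_simps)
    then show ?thesis using miss_probability_gap[OF assms] by (simp add: a_def b_def p_def)
  qed
  have gap0: "1 / (3 * (2 * r + 1)) > 0" using r0 by simp
  have m: "real m \<ge> 288 * (1 + r\<^sup>2)" unfolding m_def by linarith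
  have sq: "(2 * r + 1)\<^sup>2 \<le> 8 * (1 + r\<^sup>2)"
    using zero_le_power2[of "2 * r - 1"] r0 by (simp add: power2_eq_square algebra_simps)
  have "4 = 36 * u\<^sup>2 * (1 / (3 * u))\<^sup>2" if "u > 0" for u :: real
    using that by (simp add: power2_eq_square)
  from this[of "2 * r + 1"] have "4 = 36 * (2 * r + 1)\<^sup>2 * (1 / (3 * (2 * r + 1)))\<^sup>2"
    using r0 by linarith
  also have "\<dots> \<le> real m * (a - b)\<^sup>2"
    using sq m gap gap0 by (intro mult_mono power_mono) auto
  finally have m4: "4 \<le> real m * (a - b)\<^sup>2" .
  have "ggt_complexity n k d \<le> m"
    unfolding ggt_complexity_def V_def[symmetric]
  proof (rule rand_query_complexity_sampling[OF DQ _ _ _ m4])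
    show "b < a" using gap gap0 by linarith
  next
    fix f assume "f \<in> ggt_X n k"
    then obtain A where A: "A \<subseteq> V" "card A = k" "\<And>S. S \<subseteq> V \<Longrightarrow> S \<inter> A = {} \<Longrightarrow> \<not> f S"
      by (auto simp: ggt_X_def V_def)
    have "a = measure_pmf.prob D {S. S \<inter> A = {}}"
      unfolding D_def a_def using prob_random_subset_disjoint[OF A(1) V p] A(2) by simp
    also have "\<dots> \<le> measure_pmf.prob D {q. \<not> f q}"
      using DQ A(3) by (intro measure_pmf.finite_measure_mono_AE) (auto simp: AE_measure_pmf_iff)
    finally show "a \<le> measure_pmf.prob D {q. \<not> f q}" .
  next
    fix f assume "f \<in> ggt_Y n k d"
    then obtain B where B: "B \<subseteq> V" "card B = k + d" "\<And>S. S \<subseteq> V \<Longrightarrow> S \<inter> B \<noteq> {} \<Longrightarrow> f S"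
      by (auto simp: ggt_Y_def V_def)
    have "measure_pmf.prob D {q. \<not> f q} \<le> measure_pmf.prob D {S. S \<inter> B = {}}"
      using DQ B(3) by (intro measure_pmf.finite_measure_mono_AE) (auto simp: AE_measure_pmf_iff, blast)
    also have "\<dots> = b"
      unfolding D_def b_def using prob_random_subset_disjoint[OF B(1) V p] B(2) by simp
    finally show "measure_pmf.prob D {q. \<not> f q} \<le> b" .
  qed
  moreover have "real m \<le> 289 * (1 + r\<^sup>2)"
  proof -
    have "real m \<le> 288 * (1 + r\<^sup>2) + 1"
      unfolding m_def using of_int_ceiling_le_add_one[of "288 * (1 + r\<^sup>2)"] by simp
    then show ?thesis using zero_le_power2[of r] unfolding distrib_left by linarith
  qed
  ultimately show ?thesis unfolding r_def by linarith
qed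

section \<open>Hashing and binary search\<close>

text \<open>Tree nodes are the low \<open>i\<close> bits of the hash value, so node \<open>j\<close>
  of level \<open>i\<close> has the children \<open>j\<close> and \<open>j + 2 ^ i\<close>.\<close>

definition bucket :: "'a set \<Rightarrow> ('a \<Rightarrow> nat) \<Rightarrow> nat \<Rightarrow> nat \<Rightarrow> 'a set" where
  "bucket V h i j = {x\<in>V. h x mod 2 ^ i = j}"

text \<open>The list \<open>js\<close> holds the buckets of level \<open>i\<close> that were answered 1; each of them splits into
  two buckets of level \<open>i + 1\<close>. More than \<open>k\<close> such buckets rule out \<open>ggt_X\<close>.\<close>

primrec search :: "(nat \<Rightarrow> nat \<Rightarrow> 'q) \<Rightarrow> nat \<Rightarrow> nat \<Rightarrow> nat \<Rightarrow> nat list \<Rightarrow> 'q dtree" where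
  "search g k 0 i js = Answer (length js \<le> k)"
| "search g k (Suc r) i js =
     (if length js \<le> k
      then query_all (g (Suc i)) (js @ map (\<lambda>j. j + 2 ^ i) js) (search g k r (Suc i))
      else Answer False)"

lemma queries_search:
  assumes "\<And>i j. g i j \<in> Q"
  shows "queries (search g k r i js) \<subseteq> Q"
proof (induction r arbitrary: i js)
  case (Suc r)
  have "g (Suc i) ` set (js @ map (\<lambda>j. j + 2 ^ i) js) \<subseteq> Q" using assms by blast
  from queries_query_all[OF this Suc.IH] show ?case by simp
qed simp

lemma num_queries_search: "num_queries (search g k r i js) f \<le> 2 * k * r"
proof (induction r arbitrary: i js)
  case (Suc r)
  show ?case
    using Suc.IH[of "Suc i" "filter (\<lambda>j. f (g (Suc i) j)) (js @ map (\<lambda>j. j + 2 ^ i) js)"]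
    by (auto simp: num_queries_query_all algebra_simps)
qed simp

lemma mod_power2_Suc_cases:
  fixes x :: nat
  shows "x mod 2 ^ Suc i = x mod 2 ^ i \<or> x mod 2 ^ Suc i = x mod 2 ^ i + 2 ^ i"
  using mod_mult2_eq[of x "2 ^ i" 2] by (cases "x div 2 ^ i mod 2 = 0") (auto simp: mult.commute)

text \<open>A bucket answered 1 must meet \<open>A\<close>, so \<open>js\<close> stays a
  duplicate-free list of residues of \<open>A\<close> and never exceeds \<open>k\<close>: this side
  has no error.\<close>

lemma run_search_few:
  assumes "finite A" "card A \<le> k" "\<And>S. S \<subseteq> V \<Longrightarrow> S \<inter> A = {} \<Longrightarrow> \<not> f S"
    and "distinct js" "set js \<subseteq> (\<lambda>x. h x mod 2 ^ i) ` A"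
  shows "run (search (bucket V h) k r i js) f"
  using assms(4,5)
proof (induction r arbitrary: i js)
  have len: "length js \<le> k" if "distinct js" "set js \<subseteq> (\<lambda>x. h x mod 2 ^ i) ` A" for i js
  proof -
    have "length js = card (set js)" using that by (simp add: distinct_card)
    also have "\<dots> \<le> card ((\<lambda>x. h x mod 2 ^ i) ` A)"
      using that assms(1) by (intro card_mono) auto
    also have "\<dots> \<le> k" using card_image_le[OF assms(1)] assms(2) order_trans by blast
    finally show ?thesis .
  qed
  {
    case 0
    then show ?case using len by simp
  next
    case (Suc r)
    let ?c = "js @ map (\<lambda>j. j + 2 ^ i) js"
    let ?l = "filter (\<lambda>j. f (bucket V h (Suc i) j)) ?c"
    \<comment> \<open>Residues below \<open>2 ^ i\<close> keep \<open>js\<close> and its shift by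
      \<open>2 ^ i\<close> disjoint.\<close>
    have "\<forall>j\<in>set js. j < 2 ^ i" using Suc.prems(2) by auto
    then have "distinct ?l"
      using Suc.prems(1) by (intro distinct_filter) (auto simp: distinct_map inj_on_def)
    moreover have "set ?l \<subseteq> (\<lambda>x. h x mod 2 ^ Suc i) ` A"
    proof
      fix j assume "j \<in> set ?l"
      then have "f (bucket V h (Suc i) j)" by (simp only: set_filter mem_Collect_eq)
      then have "bucket V h (Suc i) j \<inter> A \<noteq> {}" using assms(3) by (auto simp: bucket_def)
      then show "j \<in> (\<lambda>x. h x mod 2 ^ Suc i) ` A" by (auto simp: bucket_def)
    qed
    ultimately have "run (search (bucket V h) k r (Suc i) ?l) f" by (rule Suc.IH)
    then show ?case using len[OF Suc.prems] by (simp add: run_query_all)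
  }
qed

text \<open>Buckets meeting \<open>B\<close> are answered 1, so \<open>js\<close> always covers the
  residues of \<open>B\<close>. An early abort also answers \<open>False\<close>, hence counting
  residues at the last level \<open>i + r\<close> suffices.\<close>

lemma run_search_many:
  assumes "B \<subseteq> V" "\<And>S. S \<subseteq> V \<Longrightarrow> S \<inter> B \<noteq> {} \<Longrightarrow> f S"
    and "(\<lambda>x. h x mod 2 ^ i) ` B \<subseteq> set js"
    and "card ((\<lambda>x. h x mod 2 ^ (i + r)) ` B) > k"
  shows "\<not> run (search (bucket V h) k r i js) f"
  using assms(3,4)
proof (induction r arbitrary: i js)
  case 0
  then have "k < card ((\<lambda>x. h x mod 2 ^ i) ` B)" by simp
  also have "\<dots> \<le> card (set js)" using 0 by (intro card_mono) auto
  also have "\<dots> \<le> length js" by (rule card_length)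
  finally show ?case by simp
next
  case (Suc r)
  let ?l = "filter (\<lambda>j. f (bucket V h (Suc i) j)) (js @ map (\<lambda>j. j + 2 ^ i) js)"
  have "(\<lambda>x. h x mod 2 ^ Suc i) ` B \<subseteq> set ?l"
  proof
    fix j assume "j \<in> (\<lambda>x. h x mod 2 ^ Suc i) ` B"
    then obtain x where x: "x \<in> B" "j = h x mod 2 ^ Suc i" by blast
    then have "f (bucket V h (Suc i) j)"
      using assms(1) by (intro assms(2)) (auto simp: bucket_def)
    moreover have "h x mod 2 ^ i \<in> set js" using Suc.prems(1) x(1) by auto
    ultimately show "j \<in> set ?l"
      using mod_power2_Suc_cases[of "h x" i] x(2) by auto
  qed
  then have "\<not> run (search (bucket V h) k r (Suc i) ?l) f"
    using Suc.prems(2) by (intro Suc.IH) auto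
  then show ?case by (simp add: run_query_all)
qed

section \<open>Collisions of random hash functions\<close>

lemma prob_hash_collision:
  fixes M :: nat
  assumes "finite V" "x \<in> V" "y \<in> V" "x \<noteq> y" "M > 0"
  shows "measure_pmf.prob (Pi_pmf V z (\<lambda>_. pmf_of_set {..<M})) {h. h x = h y} \<le> 1 / real M"
proof -
  let ?P = "Pi_pmf V z (\<lambda>_. pmf_of_set {..<M})"
  have M: "{..<M} \<noteq> {}" using assms by auto
  \<comment> \<open>Both points hash to \<open>v\<close>: a product event of probability
    \<open>1 / M\<^sup>2\<close> for each \<open>v < M\<close>; summing over \<open>v\<close> gives
    \<open>1 / M\<close>.\<close>
  define E where "E v = Pi V (\<lambda>w. if w \<in> {x, y} then {v} else UNIV)" for v :: nat
  have E: "measure_pmf.prob ?P (E v) = (1 / real M)\<^sup>2" if "v < M" for v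
  proof -
    have "measure_pmf.prob ?P (E v) = (\<Prod>w\<in>V. if w \<in> {x, y} then 1 / real M else 1)"
      unfolding E_def by (subst measure_Pi_pmf_Pi[OF assms(1)], rule prod.cong)
        (use that M in \<open>auto simp: measure_pmf_single indicator_def\<close>)
    also have "\<dots> = (\<Prod>w\<in>{x, y}. 1 / real M)"
      using assms by (intro prod.mono_neutral_cong_right) auto
    also have "\<dots> = (1 / real M)\<^sup>2" using assms by (simp add: power2_eq_square)
    finally show ?thesis .
  qed
  have "measure_pmf.prob ?P {h. h x = h y} \<le> measure_pmf.prob ?P (\<Union>v<M. E v)"
  proof (rule measure_pmf.finite_measure_mono_AE)
    show "AE h in measure_pmf ?P. h \<in> {h. h x = h y} \<longrightarrow> h \<in> (\<Union>v<M. E v)"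
      using assms M by (auto simp: AE_measure_pmf_iff set_Pi_pmf PiE_dflt_def E_def)
  qed auto
  also have "\<dots> \<le> (\<Sum>v<M. measure_pmf.prob ?P (E v))"
    by (rule measure_pmf.finite_measure_subadditive_finite) auto
  also have "\<dots> = 1 / real M" using E assms(5) by (simp add: power2_eq_square)
  finally show ?thesis .
qed

lemma prob_hash_not_inj:
  fixes M :: nat
  assumes "finite V" "B \<subseteq> V" "M > 0"
  shows "measure_pmf.prob (Pi_pmf V z (\<lambda>_. pmf_of_set {..<M})) {h. \<not> inj_on h B}
           \<le> real (card B * (card B - 1)) / real M"
proof -
  let ?P = "Pi_pmf V z (\<lambda>_. pmf_of_set {..<M})"
  \<comment> \<open>Ordered pairs: counting each collision twice costs only a constant
    factor.\<close>
  let ?I = "SIGMA x:B. B - {x}"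
  have B: "finite B" using assms finite_subset by blast
  have card: "card ?I = card B * (card B - 1)"
    using B by (subst card_SigmaI) (auto simp: card_Diff_singleton)
  have eq: "{h. \<not> inj_on h B} = (\<Union>(x, y)\<in>?I. {h. h x = h y})" by (auto simp: inj_on_def)
  have "measure_pmf.prob ?P {h. \<not> inj_on h B} \<le>
      (\<Sum>e\<in>?I. measure_pmf.prob ?P (case e of (x, y) \<Rightarrow> {h. h x = h y}))"
    unfolding eq using B by (intro measure_pmf.finite_measure_subadditive_finite) auto
  also have "\<dots> \<le> (\<Sum>e\<in>?I. 1 / real M)"
    using assms by (intro sum_mono) (auto intro!: prob_hash_collision)
  also have "\<dots> = real (card B * (card B - 1)) / real M" using card by simp
  finally show ?thesis .
qed

text \<open>The condition on \<open>L\<close> brings the union bound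
  \<open>(k + 1) * k / 2 ^ L\<close> for a collision among \<open>k + 1\<close> points down to
  1/3.\<close>

lemma ggt_complexity_search:
  assumes k: "k \<ge> 1" and d: "d \<ge> 1" and L: "2 ^ L \<ge> 3 * (k + 1) * k"
  shows "ggt_complexity n k d \<le> 2 * k * L"
proof -
  define V where "V = {1..n}"
  define P where "P = Pi_pmf V 0 (\<lambda>_. pmf_of_set {..<2 ^ L :: nat})"
  \<comment> \<open>The search starts at the root, bucket 0 of level 0, which is all of
    \<open>V\<close> and is taken as answered 1.\<close>
  define build where "build h = search (bucket V h) k L 0 [0]" for h :: "nat \<Rightarrow> nat"
  have V: "finite V" by (simp add: V_def)
  have "rand_decides (map_pmf build P) (Pow V) (ggt_X n k) (ggt_Y n k d)"
    unfolding rand_decides_def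
  proof (intro conjI ballI)
    fix t assume "t \<in> set_pmf (map_pmf build P)"
    then obtain h where h: "t = build h" by auto
    show "queries t \<subseteq> Pow V"
      unfolding h build_def by (intro queries_search) (auto simp: bucket_def)
  next
    fix f assume "f \<in> ggt_X n k"
    then obtain A where A: "A \<subseteq> V" "card A = k" "\<And>S. S \<subseteq> V \<Longrightarrow> S \<inter> A = {} \<Longrightarrow> \<not> f S"
      by (auto simp: ggt_X_def V_def)
    \<comment> \<open>With \<open>A\<close> nonempty, the root's residue 0 is a residue of
      \<open>A\<close>, as the invariant of the search demands.\<close>
    have "finite A" "A \<noteq> {}" using A V k finite_subset by fastforce+
    then have "run (build h) f" for h
      unfolding build_def using A by (intro run_search_few[of A]) auto
    then show "2 / 3 \<le> measure_pmf.prob (map_pmf build P) {t. run t f = True}"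
      by (simp add: vimage_def)
  next
    fix f assume "f \<in> ggt_Y n k d"
    then obtain B' where B': "B' \<subseteq> V" "card B' = k + d"
        "\<And>S. S \<subseteq> V \<Longrightarrow> S \<inter> B' \<noteq> {} \<Longrightarrow> f S"
      by (auto simp: ggt_Y_def V_def)
    \<comment> \<open>\<open>d \<ge> 1\<close> provides \<open>k + 1\<close> points; taking no more
      keeps the number of buckets independent of \<open>d\<close>.\<close>
    obtain B where B: "B \<subseteq> B'" "card B = k + 1"
      using obtain_subset_with_card_n[of "k + 1" B'] B'(2) d by auto
    have BV: "B \<subseteq> V" using B B' by auto
    have "real (3 * (k + 1) * k) \<le> real (2 ^ L)" using L by (simp only: of_nat_le_iff)
    then have "real (card B * (card B - 1)) / real (2 ^ L) \<le> 1/3"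
      using B(2) by (simp add: field_simps)
    then have bad: "measure_pmf.prob P {h. \<not> inj_on h B} \<le> 1/3"
      using prob_hash_not_inj[OF V BV, of "2 ^ L" 0] unfolding P_def by (rule order_trans[rotated]) simp
    have run: "\<not> run (build h) f" if "h \<in> set_pmf P" "inj_on h B" for h
    proof -
      have "{..<2 ^ L :: nat} \<noteq> {}" by (simp add: lessThan_empty_iff)
      then have "h x < 2 ^ L" if "x \<in> B" for x
        using \<open>h \<in> set_pmf P\<close> that BV V by (auto simp: P_def set_Pi_pmf PiE_dflt_def)
      \<comment> \<open>Hash values below \<open>2 ^ L\<close> are their own residues, so
        injectivity separates all of \<open>B\<close> at the last level.\<close>
      then have "(\<lambda>x. h x mod 2 ^ (0 + L)) ` B = h ` B" by (intro image_cong) auto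
      then have "card ((\<lambda>x. h x mod 2 ^ (0 + L)) ` B) > k"
        using card_image[OF that(2)] B(2) by simp
      moreover have "f S" if "S \<subseteq> V" "S \<inter> B \<noteq> {}" for S
        using B'(3) that B(1) by blast
      ultimately show ?thesis
        unfolding build_def using BV by (intro run_search_many[of B]) auto
    qed
    have "2/3 \<le> measure_pmf.prob P {h. inj_on h B}"
      using bad measure_pmf.prob_compl[of "{h. inj_on h B}" P]
      by (simp add: Compl_eq_Diff_UNIV[symmetric] Collect_neg_eq)
    also have "\<dots> \<le> measure_pmf.prob P {h. \<not> run (build h) f}"
      using run by (intro measure_pmf.finite_measure_mono_AE) (auto simp: AE_measure_pmf_iff)
    finally show "2 / 3 \<le> measure_pmf.prob (map_pmf build P) {t. run t f = False}"
      by (simp add: vimage_def)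
  qed
  moreover have "makes_at_most (map_pmf build P) (ggt_X n k \<union> ggt_Y n k d) (2 * k * L)"
    by (auto simp: makes_at_most_def build_def num_queries_search)
  ultimately show ?thesis
    unfolding ggt_complexity_def V_def[symmetric] by (rule rand_query_complexity_le)
qed

lemma ggt_complexity_log:
  assumes k: "k \<ge> 1" and d: "d \<ge> 1"
  shows "real (ggt_complexity n k d) \<le> 14 * max 1 (real k * log 2 (real k))"
proof -
  define l where "l = nat \<lceil>log 2 (real k)\<rceil>"
  \<comment> \<open>\<open>3 * (k + 1) * k \<le> 6 * k\<^sup>2 \<le> 8 * (2 ^ l)\<^sup>2\<close>,
    and the last term is \<open>2 ^ (2 * l + 3)\<close>.\<close>
  define L where "L = 2 * l + 3"
  have lg: "log 2 (real k) \<ge> 0" using k by simp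
  have "real k = 2 powr log 2 (real k)" using k by simp
  also have "\<dots> \<le> 2 powr real l" unfolding l_def by (intro powr_mono) (auto intro: real_nat_ceiling_ge)
  also have "\<dots> = real (2 ^ l)" by (simp add: powr_realpow)
  finally have "k \<le> 2 ^ l" by (simp only: of_nat_le_iff)
  then have "k * k \<le> 2 ^ l * 2 ^ l" by (intro mult_mono) auto
  moreover have "k \<le> k * k" using k by simp
  moreover have "(2::nat) ^ L = 8 * (2 ^ l * 2 ^ l)"
    unfolding L_def mult_2 power_add by simp
  moreover have "3 * (k + 1) * k = 3 * (k * k) + 3 * k" by (simp add: algebra_simps)
  ultimately have "3 * (k + 1) * k \<le> 2 ^ L" by linarith
  from ggt_complexity_search[OF k d this, of n]
  have "real (ggt_complexity n k d) \<le> real (2 * k * L)" by (rule of_nat_mono)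
  also have "\<dots> \<le> 2 * real k * (2 * log 2 (real k) + 5)"
  proof -
    have "real L \<le> 2 * log 2 (real k) + 5" unfolding L_def l_def using lg by simp linarith
    then show ?thesis using mult_left_mono[of "real L" _ "2 * real k"] by simp
  qed
  \<comment> \<open>For \<open>k = 1\<close> the left side is 10. For \<open>k \<ge> 2\<close> the
    logarithm is at least 1, so \<open>10 * k\<close> is absorbed into
    \<open>10 * (k * log 2 k)\<close>, and 4 + 10 = 14.\<close>
  also have "\<dots> \<le> 14 * max 1 (real k * log 2 (real k))"
  proof (cases "k = 1")
    case False
    then have "real k \<ge> 2" using k by simp
    then have "1 \<le> log 2 (real k)" by simp
    then have "real k \<le> real k * log 2 (real k)"
      using mult_left_mono[of 1 "log 2 (real k)" "real k"] by simp
    then have "2 * real k * (2 * log 2 (real k) + 5) \<le> 14 * (real k * log 2 (real k))"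
      by (simp add: algebra_simps)
    then show ?thesis by linarith
  qed simp
  finally show ?thesis .
qed

theorem theorem3p3:
  "\<exists>C>0. \<forall>n k d :: nat. n \<ge> 1 \<longrightarrow> k \<ge> 1 \<longrightarrow> d \<ge> 1 \<longrightarrow>
     real (ggt_complexity n k d) \<le> C * ggt_bound k d"
proof (intro exI[of _ 289] conjI allI impI)
  fix n k d :: nat
  assume "1 \<le> k" "1 \<le> d"
  \<comment> \<open>The two bounds have constants 289 and 14; the larger serves for both.\<close>
  with ggt_complexity_sampling[of k d n] ggt_complexity_log[of k d n]
  show "real (ggt_complexity n k d) \<le> 289 * ggt_bound k d"
    unfolding ggt_bound_def by (auto simp: min_def)
qed simp

end
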